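(* Let $G$ be a simple finite graph of order $n\geq 7$ (that is, with $n$ vertices). If $G$ has more than $$\binom{n}{2}-\left\lfloor\frac{n}{2}\right\rfloor-2$$ edges, then $G$ satisfies the Bakry--Émery curvature dimension condition $CD(0,\infty)$ with respect to the non-normalized graph Laplacian.
   Context: Let $G=(V,E)$ be a simple finite graph. The non-normalized Laplacian of $f:V\to\mathbb{R}$ is $\Delta f(x)=\sum_{y:\,xy\in E}(f(y)-f(x))$. For $f,g:V\to\mathbb{R}$ define $2\Gamma(f,g)=\Delta(fg)-f\Delta g-g\Delta f$ and $2\Gamma_2(f,g)=\Delta\Gamma(f,g)-\Gamma(f,\Delta g)-\Gamma(\Delta f,g)$, and write $\Gamma(f)=\Gamma(f,f)$, $\Gamma_2(f)=\Gamma_2(f,f)$. For $K\in\mathbb{R}$ and $N\in(0,\infty]$, a vertex $x\in V$ satisfies $CD(K,N,x)$ if for every $f:V\to\mathbb{R}$, $\Gamma_2(f)(x)\geq \frac1N(\Delta f(x))^2+K\,\Gamma(f)(x)$, with the convention $\frac1N=0$ when $N=\infty$. The graph $G$ satisfies $CD(K,N)$ if every vertex $x\in V$ satisfies $CD(K,N,x)$. In particular, $G$ satisfies $CD(0,\infty)$ if and only if $\Gamma_2(f)(x)\geq 0$ for all $f:V\to\mathbb{R}$ and all $x\in V$. *)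

theory Defs
  imports "HOL-Library.Extended_Real"
begin

text \<open>An edge \<open>xy\<close> is the two-element set \<open>{x, y}\<close>, so the number of edges is \<open>card E\<close>.\<close>

locale finite_simple_graph =
  fixes V :: "'a set" and E :: "'a set set"
  assumes finite_verts: "finite V"
    and edges: "\<And>e. e \<in> E \<Longrightarrow> e \<subseteq> V \<and> card e = 2"

text \<open>
  Functions on the vertices are total functions on \<open>'a\<close>. In a graph \<open>(V, E)\<close> all
  operators below depend, at a vertex, only on the values of their arguments on \<open>V\<close>,
  because all neighbours of a vertex lie in \<open>V\<close>.
\<close>

definition laplacian :: "'a set set \<Rightarrow> ('a \<Rightarrow> real) \<Rightarrow> 'a \<Rightarrow> real" where
  "laplacian E f x = (\<Sum>y\<in>{y. {x, y} \<in> E}. f y - f x)"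

definition Gamma1 :: "'a set set \<Rightarrow> ('a \<Rightarrow> real) \<Rightarrow> ('a \<Rightarrow> real) \<Rightarrow> 'a \<Rightarrow> real" where
  "Gamma1 E f g x =
    (laplacian E (\<lambda>y. f y * g y) x - f x * laplacian E g x - g x * laplacian E f x) / 2"

definition Gamma2 :: "'a set set \<Rightarrow> ('a \<Rightarrow> real) \<Rightarrow> ('a \<Rightarrow> real) \<Rightarrow> 'a \<Rightarrow> real" where
  "Gamma2 E f g x =
    (laplacian E (Gamma1 E f g) x - Gamma1 E f (laplacian E g) x
      - Gamma1 E (laplacian E f) g x) / 2"

text \<open>
  The dimension \<open>N\<close> is meant to range over \<open>(0, \<infinity>]\<close>; in the extended reals \<open>1 / \<infinity> = 0\<close>.
\<close>

definition CD_at :: "'a set set \<Rightarrow> real \<Rightarrow> ereal \<Rightarrow> 'a \<Rightarrow> bool" where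
  "CD_at E K N x \<longleftrightarrow>
    (\<forall>f. Gamma2 E f f x \<ge> real_of_ereal (1 / N) * (laplacian E f x)\<^sup>2 + K * Gamma1 E f f x)"

definition CD :: "'a set \<Rightarrow> 'a set set \<Rightarrow> real \<Rightarrow> ereal \<Rightarrow> bool" where
  "CD V E K N \<longleftrightarrow> (\<forall>x\<in>V. CD_at E K N x)"

lemma CD_0_infinity_iff: "CD V E 0 \<infinity> \<longleftrightarrow> (\<forall>f. \<forall>x\<in>V. Gamma2 E f f x \<ge> 0)"
  by (auto simp: CD_def CD_at_def)

end

theory Submission
  imports Defs "HOL-Analysis.Convex"
begin

text \<open>
  A dense graph is studied through the few edges it lacks. Fix a vertex \<open>x\<close> of degree \<open>d\<close>, let
  \<open>N\<close> be its neighbourhood, \<open>W\<close> the set of the \<open>k = n - 1 - d\<close> vertices that are neither \<open>x\<close> nor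
  adjacent to it, and \<open>\<phi> = f - f x\<close>. Expanding the definitions shows that \<open>4 \<Gamma>\<^sub>2(f)(x)\<close> is a
  quadratic form with one term for each arc from a neighbour \<open>y\<close> of \<open>x\<close> to a neighbour of \<open>y\<close>. If
  only pairs containing \<open>x\<close> were missing, these arcs would run to all vertices but \<open>y\<close> itself and
  the form would be explicit; each other missing pair with an end in \<open>N\<close> costs a correction
  (\<open>four_Gamma2_eq_complement\<close>).

  Let \<open>c\<close> be the mean of \<open>\<phi>\<close> on \<open>N\<close>, \<open>q = (\<Sum>y\<in>N. (\<phi> y - c)\<^sup>2)\<close> and
  \<open>h = (\<Sum>z\<in>W. (\<phi> z - 2 c)\<^sup>2)\<close>. In these coordinates the explicit form is diagonal:
  \<open>d (n + 2 - 2 k) c\<^sup>2 + 3 n q + d h\<close>. The corrections are bounded by the Dirichlet energy, on the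
  complement graph with \<open>x\<close> deleted, of the function equal to \<open>2 (\<phi> - c)\<close> on \<open>N\<close> and to
  \<open>\<phi> - 2 c\<close> on \<open>W\<close>, whose squared norm is \<open>4 q + h\<close> (\<open>nonadjacent_sum_le\<close>). The Laplacian of a
  graph with \<open>m\<close> edges has no eigenvalue above \<open>m + 1\<close> (\<open>dirichlet_le\<close>), so with \<open>m\<close> missing
  edges away from \<open>x\<close> one gets
  \<open>4 \<Gamma>\<^sub>2(f)(x) \<ge> d (n + 2 - 2 k) c\<^sup>2 + (3 n - 4 (m + 1)) q + (d - (m + 1)) h\<close>.

  The hypothesis on the number of edges says \<open>k + m \<le> n div 2 + 1\<close>. It makes the first coefficient
  nonnegative because \<open>k \<le> n div 2 + 1\<close>, and the other two because \<open>m + 1 \<le> n div 2 + 2 - k\<close> and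
  \<open>n \<ge> 7\<close>.
\<close>

section \<open>Neighbourhoods and degrees\<close>

abbreviation nbrs :: "'a set set \<Rightarrow> 'a \<Rightarrow> 'a set" where
  "nbrs E v \<equiv> {y. {v, y} \<in> E}"

lemma (in finite_simple_graph) nbrs_subset: "nbrs E v \<subseteq> V"
  using edges by fastforce

lemma (in finite_simple_graph) finite_nbrs: "finite (nbrs E v)"
  using nbrs_subset finite_verts finite_subset by blast

lemma (in finite_simple_graph) singleton_not_edge: "{v} \<notin> E"
  using edges[of "{v}"] by auto

lemma (in finite_simple_graph) vertex_partition:
  assumes "x \<in> V" and "N = nbrs E x" and "W = V - insert x N"
  shows "V = insert x (N \<union> W)" "finite N" "finite W" "x \<notin> N" "x \<notin> W" "N \<inter> W = {}"
  using assms nbrs_subset finite_nbrs finite_verts singleton_not_edge by auto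

lemma (in finite_simple_graph) card_vertex_partition:
  assumes "x \<in> V"
  shows "card V = 1 + card (nbrs E x) + card (V - insert x (nbrs E x))"
proof -
  note part = vertex_partition[OF assms refl refl]
  have "card V = card (insert x (nbrs E x \<union> (V - insert x (nbrs E x))))"
    using part(1) by (rule arg_cong)
  then show ?thesis
    using part(2-) by (simp add: card_Un_disjoint)
qed

lemma (in finite_simple_graph) finite_edges: "finite E"
  using edges finite_verts by (meson PowI finite_Pow_iff finite_subset subsetI)

lemma (in finite_simple_graph) card_edges_at: "card {e \<in> E. v \<in> e} = card (nbrs E v)"
proof -
  have "{e \<in> E. v \<in> e} = (\<lambda>y. {v, y}) ` nbrs E v"
  proof (intro equalityI subsetI)
    fix e assume e: "e \<in> {e \<in> E. v \<in> e}"
    then have "card e = 2" using edges by auto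
    then obtain a b where "e = {a, b}" by (auto simp: card_2_iff)
    with e show "e \<in> (\<lambda>y. {v, y}) ` nbrs E v" by (auto simp: insert_commute)
  qed auto
  moreover have "inj_on (\<lambda>y. {v, y}) (nbrs E v)"
    by (auto simp: inj_on_def doubleton_eq_iff)
  ultimately show ?thesis by (simp add: card_image)
qed

text \<open>The edges at \<open>v\<close> and those at \<open>z\<close> share only the edge \<open>vz\<close> itself.\<close>

lemma (in finite_simple_graph) degree_add_le:
  assumes "{v, z} \<in> E"
  shows "card (nbrs E v) + card (nbrs E z) \<le> card E + 1"
proof -
  let ?A = "\<lambda>v. {e \<in> E. v \<in> e}"
  have "?A v \<inter> ?A z \<subseteq> {{v, z}}"
  proof
    fix e assume e: "e \<in> ?A v \<inter> ?A z"
    then have "card e = 2" using edges by auto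
    then obtain a b where "e = {a, b}" by (auto simp: card_2_iff)
    with e assms singleton_not_edge[of v] show "e \<in> {{v, z}}" by auto
  qed
  then have "card (?A v \<inter> ?A z) \<le> 1"
    using card_mono[of "{{v, z}}"] by fastforce
  moreover have "card (?A v \<union> ?A z) \<le> card E"
    by (rule card_mono[OF finite_edges]) auto
  moreover have "card (?A v) + card (?A z) = card (?A v \<union> ?A z) + card (?A v \<inter> ?A z)"
    by (rule card_Un_Int) (auto simp: finite_edges)
  ultimately show ?thesis by (simp add: card_edges_at)
qed

lemma (in finite_simple_graph) sum_nbrs_eq_if:
  "(\<Sum>z\<in>nbrs E v. h z) = (\<Sum>z\<in>V. if {v, z} \<in> E then h z else (0::real))"
proof -
  have "nbrs E v = {z \<in> V. {v, z} \<in> E}" using nbrs_subset by auto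
  then show ?thesis by (simp add: sum.inter_filter[OF finite_verts])
qed

lemma (in finite_simple_graph) sum_arcs_swap:
  "(\<Sum>v\<in>V. \<Sum>z\<in>nbrs E v. h v z) = (\<Sum>v\<in>V. \<Sum>z\<in>nbrs E v. (h z v :: real))"
  unfolding sum_nbrs_eq_if by (subst sum.swap) (simp add: insert_commute)

section \<open>The largest Laplacian eigenvalue\<close>

text \<open>
  Cauchy--Schwarz bounds \<open>(\<Delta>u v)\<^sup>2\<close> by the degree of \<open>v\<close> times the energy of the edges at \<open>v\<close>.
  Summing over \<open>v\<close>, every edge \<open>vz\<close> receives the weight \<open>deg v + deg z\<close>, which is at most one more
  than the number of edges. This is the argument behind the Anderson--Morley eigenvalue bound.
\<close>

lemma (in finite_simple_graph) sum_square_laplacian_le: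
  fixes u :: "'a \<Rightarrow> real"
  shows "(\<Sum>v\<in>V. (laplacian E u v)\<^sup>2)
    \<le> real (card E + 1) * (\<Sum>v\<in>V. \<Sum>z\<in>nbrs E v. (u z - u v)\<^sup>2) / 2"
proof -
  let ?d = "\<lambda>v. real (card (nbrs E v))" and ?w = "\<lambda>v z. (u z - u v)\<^sup>2"
  have sq: "(laplacian E u v)\<^sup>2 \<le> (\<Sum>z\<in>nbrs E v. ?d v * ?w v z)" for v
    using sum_squared_le_sum_of_squares[of "\<lambda>z. u z - u v" "nbrs E v"]
    by (simp add: laplacian_def sum_distrib_left mult.commute)
  \<comment> \<open>Averaging an arc with its reversal turns the weight at one end into the sum over both ends.\<close>
  have "2 * (\<Sum>v\<in>V. \<Sum>z\<in>nbrs E v. ?d v * ?w v z)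
      = (\<Sum>v\<in>V. \<Sum>z\<in>nbrs E v. ?d v * ?w v z) + (\<Sum>v\<in>V. \<Sum>z\<in>nbrs E v. ?d z * ?w z v)"
    using sum_arcs_swap[of "\<lambda>v z. ?d v * ?w v z"] by simp
  also have "\<dots> = (\<Sum>v\<in>V. \<Sum>z\<in>nbrs E v. (?d v + ?d z) * ?w v z)"
    by (simp add: sum.distrib distrib_right power2_commute)
  also have "\<dots> \<le> (\<Sum>v\<in>V. \<Sum>z\<in>nbrs E v. real (card E + 1) * ?w v z)"
  proof (intro sum_mono mult_right_mono)
    fix v z assume "z \<in> nbrs E v"
    then show "?d v + ?d z \<le> real (card E + 1)"
      using degree_add_le[of v z] by (metis mem_Collect_eq of_nat_add of_nat_mono)
  qed auto
  finally have "2 * (\<Sum>v\<in>V. \<Sum>z\<in>nbrs E v. ?d v * ?w v z)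
      \<le> real (card E + 1) * (\<Sum>v\<in>V. \<Sum>z\<in>nbrs E v. ?w v z)"
    by (simp add: sum_distrib_left)
  moreover have "(\<Sum>v\<in>V. (laplacian E u v)\<^sup>2) \<le> (\<Sum>v\<in>V. \<Sum>z\<in>nbrs E v. ?d v * ?w v z)"
    by (intro sum_mono sq)
  ultimately show ?thesis by simp
qed

text \<open>
  Write \<open>l = card E + 1\<close>, \<open>U\<close> for the squared norm of \<open>u\<close>, and \<open>D\<close> for the left-hand side, in which
  each edge counts twice. Since \<open>-\<Delta>\<close> is the matrix of the form \<open>D / 2\<close>, expanding
  \<open>(\<Sum>v\<in>V. (l u v + \<Delta>u v)\<^sup>2) \<ge> 0\<close> gives \<open>l D \<le> l\<^sup>2 U + (\<Sum>v\<in>V. (\<Delta>u v)\<^sup>2)\<close>, and the last sum is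
  at most \<open>l D / 2\<close>. So the spectral bound follows without eigenvectors.
\<close>

lemma (in finite_simple_graph) dirichlet_le:
  fixes u :: "'a \<Rightarrow> real"
  shows "(\<Sum>v\<in>V. \<Sum>z\<in>nbrs E v. (u z - u v)\<^sup>2) \<le> 2 * real (card E + 1) * (\<Sum>v\<in>V. (u v)\<^sup>2)"
proof -
  let ?D = "\<Sum>v\<in>V. \<Sum>z\<in>nbrs E v. (u z - u v)\<^sup>2" and ?l = "real (card E + 1)"
  have "?D = (\<Sum>v\<in>V. \<Sum>z\<in>nbrs E v. u z * (u z - u v)) - (\<Sum>v\<in>V. \<Sum>z\<in>nbrs E v. u v * (u z - u v))"
    by (simp add: sum_subtractf[symmetric] power2_eq_square algebra_simps)
  also have "(\<Sum>v\<in>V. \<Sum>z\<in>nbrs E v. u z * (u z - u v)) = (\<Sum>v\<in>V. \<Sum>z\<in>nbrs E v. u v * (u v - u z))"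
    by (rule sum_arcs_swap)
  also have "\<dots> = - (\<Sum>v\<in>V. \<Sum>z\<in>nbrs E v. u v * (u z - u v))"
    by (simp add: sum_negf[symmetric] algebra_simps)
  finally have DD: "?D = - 2 * (\<Sum>v\<in>V. \<Sum>z\<in>nbrs E v. u v * (u z - u v))"
    by simp
  have D: "(\<Sum>v\<in>V. u v * laplacian E u v) = - ?D / 2"
  proof -
    have "(\<Sum>v\<in>V. u v * laplacian E u v) = (\<Sum>v\<in>V. \<Sum>z\<in>nbrs E v. u v * (u z - u v))"
      by (simp add: laplacian_def sum_distrib_left)
    then show ?thesis using DD by linarith
  qed
  have "0 \<le> (\<Sum>v\<in>V. (?l * u v + laplacian E u v)\<^sup>2)"
    by (intro sum_nonneg) simp
  also have "\<dots> = (\<Sum>v\<in>V. ?l\<^sup>2 * (u v)\<^sup>2 + 2 * ?l * (u v * laplacian E u v) + (laplacian E u v)\<^sup>2)"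
    by (intro sum.cong refl) (simp add: power2_eq_square algebra_simps)
  also have "\<dots> = ?l\<^sup>2 * (\<Sum>v\<in>V. (u v)\<^sup>2) - ?l * ?D + (\<Sum>v\<in>V. (laplacian E u v)\<^sup>2)"
    using D by (simp only: sum.distrib sum_distrib_left[symmetric])
  also have "\<dots> \<le> ?l\<^sup>2 * (\<Sum>v\<in>V. (u v)\<^sup>2) - ?l * ?D + ?l * ?D / 2"
    using sum_square_laplacian_le[of u] by simp
  finally have "?l * ?D \<le> ?l * (2 * ?l * (\<Sum>v\<in>V. (u v)\<^sup>2))"
    by (simp only: power2_eq_square mult.assoc mult.left_commute[of ?l 2])
  then show ?thesis
    by (subst (asm) mult_le_cancel_left_pos) auto
qed

section \<open>The form \<open>\<Gamma>\<^sub>2\<close> at a vertex\<close>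

lemma Gamma1_eq_sum:
  "Gamma1 E f g x = (\<Sum>y\<in>nbrs E x. (f y - f x) * (g y - g x)) / 2"
  unfolding Gamma1_def laplacian_def
  by (simp add: sum_distrib_left sum_subtractf[symmetric] algebra_simps)

lemma Gamma1_commute: "Gamma1 E f g = Gamma1 E g f"
  by (rule ext) (simp add: Gamma1_eq_sum mult.commute)

text \<open>
  By definition \<open>4 \<Gamma>\<^sub>2(f) = 2 \<Delta>\<Gamma>(f) - 4 \<Gamma>(f, \<Delta>f)\<close>. At \<open>x\<close>, where \<open>\<phi>\<close> vanishes, the term
  \<open>2 \<Delta>\<Gamma>(f)\<close> contributes \<open>(\<phi> z - \<phi> y)\<^sup>2\<close> for each arc \<open>yz\<close> with \<open>y\<close> adjacent to \<open>x\<close>, and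
  \<open>-4 \<Gamma>(f, \<Delta>f)\<close> contributes \<open>-2 \<phi> y (\<phi> z - \<phi> y)\<close> for the same arc; together
  they are the summand below. The remaining two terms come from the values of \<open>\<Gamma>(f)\<close> and \<open>\<Delta>f\<close> at
  \<open>x\<close>.
\<close>

lemma four_Gamma2_eq:
  fixes f :: "'a \<Rightarrow> real" and x :: 'a
  defines "\<phi> \<equiv> \<lambda>y. f y - f x"
  shows "4 * Gamma2 E f f x =
    (\<Sum>y\<in>nbrs E x. \<Sum>z\<in>nbrs E y. (\<phi> z)\<^sup>2 - 4 * \<phi> y * \<phi> z + 3 * (\<phi> y)\<^sup>2)
    - real (card (nbrs E x)) * (\<Sum>y\<in>nbrs E x. (\<phi> y)\<^sup>2) + 2 * (\<Sum>y\<in>nbrs E x. \<phi> y)\<^sup>2"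
proof -
  let ?N = "nbrs E"
  let ?Q = "\<Sum>y\<in>?N x. (\<phi> y)\<^sup>2" and ?S = "\<Sum>y\<in>?N x. \<phi> y"
  have L: "laplacian E f y = (\<Sum>z\<in>?N y. \<phi> z - \<phi> y)" for y
    by (simp add: laplacian_def \<phi>_def)
  have G: "2 * Gamma1 E f f y = (\<Sum>z\<in>?N y. (\<phi> z - \<phi> y)\<^sup>2)" for y
    by (simp add: Gamma1_eq_sum \<phi>_def power2_eq_square)
  have x0: "\<phi> x = 0" by (simp add: \<phi>_def)
  have "4 * Gamma2 E f f x = 2 * laplacian E (Gamma1 E f f) x - 4 * Gamma1 E f (laplacian E f) x"
    by (simp add: Gamma2_def Gamma1_commute[of E "laplacian E f"])
  also have "2 * laplacian E (Gamma1 E f f) x = (\<Sum>y\<in>?N x. (\<Sum>z\<in>?N y. (\<phi> z - \<phi> y)\<^sup>2) - ?Q)"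
    unfolding laplacian_def sum_distrib_left right_diff_distrib G by (simp add: x0)
  also have "4 * Gamma1 E f (laplacian E f) x
      = (\<Sum>y\<in>?N x. 2 * \<phi> y * ((\<Sum>z\<in>?N y. \<phi> z - \<phi> y) - ?S))"
  proof -
    have "f y - f x = \<phi> y" for y by (simp add: \<phi>_def)
    then show ?thesis
      unfolding Gamma1_eq_sum L by (simp add: x0 sum_distrib_left[symmetric] mult.assoc)
  qed
  also have "(\<Sum>y\<in>?N x. (\<Sum>z\<in>?N y. (\<phi> z - \<phi> y)\<^sup>2) - ?Q) - \<dots>
     = (\<Sum>y\<in>?N x. (\<Sum>z\<in>?N y. (\<phi> z - \<phi> y)\<^sup>2 - 2 * \<phi> y * (\<phi> z - \<phi> y)) - ?Q + 2 * ?S * \<phi> y)"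
  proof -
    have "(\<Sum>z\<in>?N y. (\<phi> z - \<phi> y)\<^sup>2) - ?Q - 2 * \<phi> y * ((\<Sum>z\<in>?N y. \<phi> z - \<phi> y) - ?S)
      = (\<Sum>z\<in>?N y. (\<phi> z - \<phi> y)\<^sup>2 - 2 * \<phi> y * (\<phi> z - \<phi> y)) - ?Q + 2 * ?S * \<phi> y" for y
      by (simp only: sum_subtractf[of "\<lambda>z. (\<phi> z - \<phi> y)\<^sup>2"] sum_distrib_left[symmetric])
         (simp only: algebra_simps)
    then show ?thesis by (simp only: sum_subtractf[symmetric])
  qed
  also have "\<dots> = (\<Sum>y\<in>?N x. (\<Sum>z\<in>?N y. (\<phi> z)\<^sup>2 - 4 * \<phi> y * \<phi> z + 3 * (\<phi> y)\<^sup>2) - ?Q + 2 * ?S * \<phi> y)"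
    by (simp add: power2_eq_square algebra_simps)
  also have "\<dots> = (\<Sum>y\<in>?N x. (\<Sum>z\<in>?N y. (\<phi> z)\<^sup>2 - 4 * \<phi> y * \<phi> z + 3 * (\<phi> y)\<^sup>2)) - real (card (?N x)) * ?Q + 2 * ?S\<^sup>2"
    by (simp add: sum.distrib sum_subtractf sum_distrib_left[symmetric] power2_eq_square)
  finally show ?thesis .
qed

text \<open>
  The inner sum of the previous formula is extended from the neighbours of \<open>y\<close> to all of \<open>V\<close>, where
  it depends only on sums and sums of squares over \<open>N\<close> and \<open>W\<close>. The last term takes back what was
  added. It includes \<open>z = y\<close>, which is harmless as \<open>G y y = 0\<close>.
\<close>

lemma (in finite_simple_graph) four_Gamma2_eq_complement:
  fixes f :: "'a \<Rightarrow> real" and x :: 'a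
  assumes x: "x \<in> V"
  defines "\<phi> \<equiv> \<lambda>y. f y - f x"
  defines "N \<equiv> nbrs E x"
  defines "W \<equiv> V - insert x N"
  defines "G \<equiv> \<lambda>y z. (\<phi> z)\<^sup>2 - 4 * \<phi> y * \<phi> z + 3 * (\<phi> y)\<^sup>2"
  shows "4 * Gamma2 E f f x =
    3 * real (card V) * (\<Sum>y\<in>N. (\<phi> y)\<^sup>2) - 2 * (\<Sum>y\<in>N. \<phi> y)\<^sup>2
    + real (card N) * (\<Sum>z\<in>W. (\<phi> z)\<^sup>2) - 4 * (\<Sum>y\<in>N. \<phi> y) * (\<Sum>z\<in>W. \<phi> z)
    - (\<Sum>y\<in>N. \<Sum>z\<in>V - nbrs E y. G y z)"
proof -
  let ?Q = "\<Sum>y\<in>N. (\<phi> y)\<^sup>2" and ?S = "\<Sum>y\<in>N. \<phi> y"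
  let ?T = "\<Sum>z\<in>W. \<phi> z" and ?P = "\<Sum>z\<in>W. (\<phi> z)\<^sup>2"
  have V: "V = insert x (N \<union> W)" and fin: "finite N" "finite W"
    and disj: "x \<notin> N" "x \<notin> W" "N \<inter> W = {}"
    using vertex_partition[OF x refl refl] unfolding N_def W_def by blast+
  have x0: "\<phi> x = 0" by (simp add: \<phi>_def)
  have T: "(\<Sum>z\<in>V. \<phi> z) = ?S + ?T" and P: "(\<Sum>z\<in>V. (\<phi> z)\<^sup>2) = ?Q + ?P"
    unfolding V using fin disj by (simp_all add: x0 sum.union_disjoint)
  have "(\<Sum>y\<in>N. \<Sum>z\<in>nbrs E y. G y z)
      = (\<Sum>y\<in>N. (\<Sum>z\<in>V. G y z) - (\<Sum>z\<in>V - nbrs E y. G y z))"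
    using nbrs_subset finite_verts by (simp add: sum_diff)
  also have "\<dots> = (\<Sum>y\<in>N. \<Sum>z\<in>V. G y z) - (\<Sum>y\<in>N. \<Sum>z\<in>V - nbrs E y. G y z)"
    by (rule sum_subtractf)
  also have "(\<Sum>y\<in>N. \<Sum>z\<in>V. G y z)
      = (\<Sum>y\<in>N. (?Q + ?P) - 4 * (?S + ?T) * \<phi> y + 3 * real (card V) * (\<phi> y)\<^sup>2)"
    unfolding G_def
    by (simp only: sum.distrib[of _ _ V] sum_subtractf[of _ _ V] sum_distrib_left[symmetric]
        sum_constant T P) (simp only: algebra_simps)
  also have "\<dots> = real (card N) * (?Q + ?P) - 4 * (?S + ?T) * ?S + 3 * real (card V) * ?Q"
    by (simp only: sum.distrib sum_subtractf sum_distrib_left[symmetric] sum_constant)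
       (simp add: distrib_left)
  finally have "(\<Sum>y\<in>N. \<Sum>z\<in>nbrs E y. G y z)
    = real (card N) * (?Q + ?P) - 4 * (?S + ?T) * ?S + 3 * real (card V) * ?Q
      - (\<Sum>y\<in>N. \<Sum>z\<in>V - nbrs E y. G y z)" .
  moreover have "4 * Gamma2 E f f x =
    (\<Sum>y\<in>N. \<Sum>z\<in>nbrs E y. G y z) - real (card N) * ?Q + 2 * ?S\<^sup>2"
    using four_Gamma2_eq[of E f x] by (simp only: \<phi>_def N_def G_def)
  ultimately show ?thesis by (simp add: power2_eq_square algebra_simps)
qed

section \<open>Missing edges\<close>

definition complement_edges :: "'a set \<Rightarrow> 'a set set \<Rightarrow> 'a set set" where
  "complement_edges V E = {e. e \<subseteq> V \<and> card e = 2 \<and> e \<notin> E}"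

lemma complement_edges_iff:
  "{y, z} \<in> complement_edges V E \<longleftrightarrow> y \<in> V \<and> z \<in> V \<and> y \<noteq> z \<and> {y, z} \<notin> E"
  by (auto simp: complement_edges_def card_2_iff doubleton_eq_iff)

lemma (in finite_simple_graph) complement_simple_graph:
  "finite_simple_graph V (complement_edges V E)"
  by unfold_locales (auto simp: complement_edges_def finite_verts)

lemma (in finite_simple_graph) card_complement_edges:
  "card (complement_edges V E) + card E = card V choose 2"
proof -
  have "complement_edges V E \<union> E = {e. e \<subseteq> V \<and> card e = 2}"
    and "complement_edges V E \<inter> E = {}"
    using edges by (auto simp: complement_edges_def)
  then show ?thesis
    using n_subsets[OF finite_verts, of 2] card_Un_disjoint[of "complement_edges V E" E]
      finite_edges finite_simple_graph.finite_edges[OF complement_simple_graph] by simp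
qed

text \<open>The missing edges at \<open>x\<close> are the pairs of \<open>x\<close> with a non-neighbour of \<open>x\<close>.\<close>

lemma (in finite_simple_graph) card_complement_edges_off:
  assumes x: "x \<in> V"
  shows "card (complement_edges (V - {x}) E) + card (V - insert x (nbrs E x))
    = card (complement_edges V E)"
proof -
  interpret C: finite_simple_graph V "complement_edges V E" by (rule complement_simple_graph)
  let ?A = "{e \<in> complement_edges V E. x \<in> e}"
  have "nbrs (complement_edges V E) x = V - insert x (nbrs E x)"
    using x by (auto simp: complement_edges_iff)
  then have "card ?A = card (V - insert x (nbrs E x))"
    by (metis C.card_edges_at)
  moreover have "complement_edges V E = complement_edges (V - {x}) E \<union> ?A"
    and "complement_edges (V - {x}) E \<inter> ?A = {}"
    by (auto simp: complement_edges_def)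
  ultimately show ?thesis
    by (metis (lifting) C.finite_edges card_Un_disjoint finite_Un)
qed

text \<open>
  The function \<open>u\<close> in the proof rescales \<open>\<phi>\<close> so that every missing pair with an end in \<open>N\<close> contributes
  at most its Dirichlet energy. A missing pair \<open>yz\<close> inside \<open>N\<close> occurs in both orders and
  \<open>G y z + G z y = 4 (\<phi> z - \<phi> y)\<^sup>2 = (u z - u y)\<^sup>2\<close>. For \<open>y \<in> N\<close> and \<open>z \<in> W\<close> it occurs once and
  \<open>G y z = (\<phi> z - 2 \<phi> y)\<^sup>2 - (\<phi> y)\<^sup>2 \<le> (u z - u y)\<^sup>2\<close>. The shift by \<open>c\<close> cancels in both
  differences, so it is a free parameter.
\<close>

lemma (in finite_simple_graph) nonadjacent_sum_le:
  fixes \<phi> :: "'a \<Rightarrow> real" and c :: real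
  assumes x: "x \<in> V"
  defines "N \<equiv> nbrs E x"
  defines "W \<equiv> V - insert x N"
  defines "G \<equiv> \<lambda>y z. (\<phi> z)\<^sup>2 - 4 * \<phi> y * \<phi> z + 3 * (\<phi> y)\<^sup>2"
  shows "(\<Sum>y\<in>N. \<Sum>z\<in>V - nbrs E y. G y z)
    \<le> real (card (complement_edges (V - {x}) E) + 1)
        * (4 * (\<Sum>y\<in>N. (\<phi> y - c)\<^sup>2) + (\<Sum>z\<in>W. (\<phi> z - 2 * c)\<^sup>2))"
proof -
  let ?C = "complement_edges (V - {x}) E"
  interpret C: finite_simple_graph "V - {x}" ?C
    by unfold_locales (auto simp: complement_edges_def finite_verts)
  define u where "u v = (if v \<in> N then 2 * (\<phi> v - c) else \<phi> v - 2 * c)" for v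
  define b :: "'a \<Rightarrow> 'a \<Rightarrow> real" where "b y z = (if {y, z} \<in> ?C then 1 else 0)" for y z
  note part = vertex_partition[OF x N_def[THEN meta_eq_to_obj_eq] W_def[THEN meta_eq_to_obj_eq]]
  then have V: "V - {x} = N \<union> W" and fin: "finite N" "finite W" and disj: "N \<inter> W = {}"
    by auto
  have b_sym: "b y z = b z y" for y z by (simp add: b_def insert_commute)
  have b0: "0 \<le> b y z" for y z by (simp add: b_def)
  have split: "(\<Sum>v\<in>V - {x}. h v) = (\<Sum>v\<in>N. h v) + (\<Sum>v\<in>W. h v)" for h :: "'a \<Rightarrow> real"
    unfolding V using fin disj by (rule sum.union_disjoint)
  let ?D = "\<lambda>A B. \<Sum>y\<in>A. \<Sum>z\<in>B. b y z * (u z - u y)\<^sup>2"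
  have row: "(\<Sum>z\<in>V - nbrs E y. G y z) = (\<Sum>z\<in>N. b y z * G y z) + (\<Sum>z\<in>W. b y z * G y z)"
    if y: "y \<in> N" for y
  proof -
    have "(\<Sum>z\<in>V - nbrs E y. G y z) = (\<Sum>z\<in>V - {x}. b y z * G y z)"
    proof (rule sum.mono_neutral_cong)
      fix z assume "z \<in> V - {x} - (V - nbrs E y)"
      then show "b y z * G y z = 0" by (auto simp: b_def complement_edges_def)
    next
      \<comment> \<open>The remaining candidate \<open>z = x\<close> is excluded because \<open>y\<close> is adjacent to \<open>x\<close>.\<close>
      fix z assume z: "z \<in> V - nbrs E y - (V - {x})"
      then show "G y z = 0" using y by (auto simp: N_def insert_commute)
    next
      fix z assume z: "z \<in> (V - nbrs E y) \<inter> (V - {x})"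
      show "G y z = b y z * G y z"
      proof (cases "z = y")
        case True then show ?thesis by (simp add: G_def power2_eq_square)
      next
        case False
        then show ?thesis using z y V by (auto simp: b_def complement_edges_iff)
      qed
    qed (auto simp: finite_verts)
    then show ?thesis by (simp add: split)
  qed
  have "2 * (\<Sum>y\<in>N. \<Sum>z\<in>N. b y z * G y z)
      = (\<Sum>y\<in>N. \<Sum>z\<in>N. b y z * G y z) + (\<Sum>y\<in>N. \<Sum>z\<in>N. b z y * G z y)"
    using sum.swap[of "\<lambda>y z. b y z * G y z" N N] by simp
  also have "\<dots> = ?D N N"
    unfolding sum.distrib[symmetric]
    by (intro sum.cong refl)
       (simp add: u_def b_sym[of _ y for y] G_def power2_eq_square algebra_simps)
  finally have NN: "2 * (\<Sum>y\<in>N. \<Sum>z\<in>N. b y z * G y z) = ?D N N" .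
  have NW: "(\<Sum>y\<in>N. \<Sum>z\<in>W. b y z * G y z) \<le> ?D N W"
  proof (intro sum_mono mult_left_mono b0)
    fix y z assume "y \<in> N" "z \<in> W"
    then have "u z - u y = \<phi> z - 2 * \<phi> y" using disj by (auto simp: u_def)
    then have "(u z - u y)\<^sup>2 = (\<phi> z - 2 * \<phi> y)\<^sup>2" by (simp only:)
    also have "\<dots> = G y z + (\<phi> y)\<^sup>2"
      by (simp add: G_def power2_eq_square algebra_simps)
    finally have "(u z - u y)\<^sup>2 = G y z + (\<phi> y)\<^sup>2" .
    then show "G y z \<le> (u z - u y)\<^sup>2" by simp
  qed
  have WN: "?D W N = ?D N W"
    by (subst sum.swap) (simp add: b_sym power2_commute)
  have "0 \<le> ?D W W" by (intro sum_nonneg mult_nonneg_nonneg b0) simp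
  then have "2 * (\<Sum>y\<in>N. \<Sum>z\<in>V - nbrs E y. G y z) \<le> ?D N N + ?D N W + ?D W N + ?D W W"
    using NN NW WN by (simp add: row sum.distrib)
  also have "\<dots> = ?D (V - {x}) (V - {x})"
    by (simp add: split sum.distrib)
  also have "\<dots> = (\<Sum>v\<in>V - {x}. \<Sum>z\<in>nbrs ?C v. (u z - u v)\<^sup>2)"
    unfolding C.sum_nbrs_eq_if by (intro sum.cong refl) (simp add: b_def)
  also have "\<dots> \<le> 2 * real (card ?C + 1) * (\<Sum>v\<in>V - {x}. (u v)\<^sup>2)"
    by (rule C.dirichlet_le)
  also have "(\<Sum>v\<in>V - {x}. (u v)\<^sup>2)
      = 4 * (\<Sum>y\<in>N. (\<phi> y - c)\<^sup>2) + (\<Sum>z\<in>W. (\<phi> z - 2 * c)\<^sup>2)"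
  proof -
    have "(\<Sum>v\<in>N. (u v)\<^sup>2) = 4 * (\<Sum>y\<in>N. (\<phi> y - c)\<^sup>2)"
      unfolding sum_distrib_left by (intro sum.cong refl) (simp add: u_def power2_eq_square algebra_simps)
    moreover have "(\<Sum>v\<in>W. (u v)\<^sup>2) = (\<Sum>z\<in>W. (\<phi> z - 2 * c)\<^sup>2)"
      using disj by (intro sum.cong refl) (auto simp: u_def)
    ultimately show ?thesis by (simp add: split)
  qed
  finally show ?thesis
    by (simp only: mult.assoc mult_le_cancel_left_pos zero_less_numeral)
qed

section \<open>Nonnegativity of \<open>\<Gamma>\<^sub>2\<close>\<close>

lemma sum_square_shift:
  fixes g :: "'a \<Rightarrow> real"
  shows "(\<Sum>y\<in>A. (g y - c)\<^sup>2) = (\<Sum>y\<in>A. (g y)\<^sup>2) - 2 * c * (\<Sum>y\<in>A. g y) + real (card A) * c\<^sup>2"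
proof -
  have "(\<Sum>y\<in>A. (g y - c)\<^sup>2) = (\<Sum>y\<in>A. (g y)\<^sup>2 - (2 * c) * g y + c\<^sup>2)"
    by (intro sum.cong refl) (simp add: power2_diff)
  also have "\<dots> = (\<Sum>y\<in>A. (g y)\<^sup>2) - 2 * c * (\<Sum>y\<in>A. g y) + real (card A) * c\<^sup>2"
    by (simp only: sum.distrib sum_subtractf sum_distrib_left[symmetric] sum_constant)
  finally show ?thesis .
qed

text \<open>
  The last three conditions say that the coefficients of the diagonal lower bound are nonnegative: as
  \<open>n = 1 + d + k\<close>, the coefficient \<open>n + 2 - 2 k\<close> of \<open>d c\<^sup>2\<close> equals \<open>2 d + 4 - n\<close>. The condition
  \<open>0 < d\<close> lets \<open>c = S / d\<close> be the mean.
\<close>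

lemma (in finite_simple_graph) Gamma2_nonneg_at:
  fixes f :: "'a \<Rightarrow> real" and x :: 'a
  assumes x: "x \<in> V"
  defines "d \<equiv> card (nbrs E x)" and "l \<equiv> card (complement_edges (V - {x}) E) + 1"
  assumes d: "0 < d" "card V \<le> 2 * d + 4" "l \<le> d" "4 * l \<le> 3 * card V"
  shows "0 \<le> Gamma2 E f f x"
proof -
  define N where "N = nbrs E x"
  define W where "W = V - insert x N"
  define \<phi> where "\<phi> y = f y - f x" for y
  define S T Q P where "S = (\<Sum>y\<in>N. \<phi> y)" and "T = (\<Sum>z\<in>W. \<phi> z)"
    and "Q = (\<Sum>y\<in>N. (\<phi> y)\<^sup>2)" and "P = (\<Sum>z\<in>W. (\<phi> z)\<^sup>2)"
  \<comment> \<open>The centres \<open>c\<close> on \<open>N\<close> and \<open>2 c\<close> on \<open>W\<close> make the mixed term \<open>S T\<close> cancel.\<close>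
  define c where "c = S / d"
  define q h where "q = (\<Sum>y\<in>N. (\<phi> y - c)\<^sup>2)" and "h = (\<Sum>z\<in>W. (\<phi> z - 2 * c)\<^sup>2)"
  let ?d = "real d" and ?n = "real (card V)" and ?k = "real (card W)"
  have n: "?n = 1 + ?d + ?k"
    using card_vertex_partition[OF x] by (simp add: d_def W_def N_def)
  have S: "S = ?d * c" using d by (simp add: c_def)
  have Q: "Q = ?d * c\<^sup>2 + q"
    using sum_square_shift[of \<phi> c N] S
    by (simp add: q_def Q_def S_def[symmetric] d_def N_def[symmetric] power2_eq_square)
  have P: "P = h + 4 * c * T - 4 * ?k * c\<^sup>2"
    using sum_square_shift[of \<phi> "2 * c" W]
    by (simp add: h_def P_def T_def[symmetric] power2_eq_square)
  have "0 \<le> ?d * c\<^sup>2 * (2 * ?d + 4 - ?n) + (3 * ?n - 4 * real l) * q + (?d - real l) * h"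
  proof -
    have "0 \<le> q" "0 \<le> h" by (auto simp: q_def h_def intro: sum_nonneg)
    then show ?thesis using d by (intro add_nonneg_nonneg mult_nonneg_nonneg) auto
  qed
  also have "\<dots> = 3 * ?n * Q - 2 * S\<^sup>2 + ?d * P - 4 * S * T - real l * (4 * q + h)"
    unfolding S Q P n by (simp add: power2_eq_square algebra_simps)
  also have "\<dots> \<le> 4 * Gamma2 E f f x"
    using four_Gamma2_eq_complement[OF x, of f] nonadjacent_sum_le[OF x, of \<phi> c]
    unfolding S_def T_def Q_def P_def q_def h_def W_def N_def \<phi>_def d_def l_def by linarith
  finally show ?thesis by simp
qed

theorem theorem1p1:
  fixes V :: "'a set" and E :: "'a set set" and n :: nat
  assumes "finite_simple_graph V E"
    and "card V = n"
    and "n \<ge> 7"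
    and "int (card E) > int (n choose 2) - int (n div 2) - 2"
  shows "CD V E 0 \<infinity>"
  unfolding CD_0_infinity_iff
proof (intro allI ballI)
  interpret finite_simple_graph V E by (rule assms(1))
  fix f :: "'a \<Rightarrow> real" and x assume x: "x \<in> V"
  let ?d = "card (nbrs E x)" and ?k = "card (V - insert x (nbrs E x))"
  let ?m = "card (complement_edges (V - {x}) E)"
  have m: "?m + ?k \<le> n div 2 + 1"
    using card_complement_edges card_complement_edges_off[OF x] assms(2,4) by simp
  have n: "n = 1 + ?d + ?k"
    using card_vertex_partition[OF x] assms(2) by simp
  \<comment> \<open>For \<open>n \<ge> 8\<close> the bound \<open>4 (n / 2 + 2) \<le> 3 n\<close> suffices; for \<open>n = 7\<close> the rounding is needed.\<close>
  have "4 * (?m + 1) \<le> 3 * n"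
  proof (cases "n = 7")
    case True
    with m show ?thesis by simp
  next
    case False
    with assms(3) have "8 \<le> n" by simp
    moreover have "2 * (n div 2) \<le> n" "?m + 1 \<le> n div 2 + 2" using m by simp_all
    moreover have "4 * a \<le> 3 * n" if "8 \<le> n" "2 * r \<le> n" "a \<le> r + 2" for a r :: nat
      using that by linarith
    ultimately show ?thesis by blast
  qed
  then show "0 \<le> Gamma2 E f f x"
    by (intro Gamma2_nonneg_at[OF x]) (use m n assms(2,3) in linarith)+
qed

end
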